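(* Let $n\geq 1$. With the notation $\Theta_{CH_n}$, $\Theta_{OH_n}$, $\Theta_{PH_n}$, $\theta_{CH_n}$, $\theta_{OH_n}$, $\theta_{PH_n}$ of the context: **(i)** For each $S\in Sp(2n,\mathbb{R})$ there is a map $\varphi_S$ from controllable Hamiltonian representations to port-Hamiltonian systems in normal form, given in terms of the parameters $(\mathbf{d},\mathbf{v})\in\Theta_{CH_n}$ by $$\varphi_S:\ \theta_{CH_n}(\mathbf{d},\mathbf{v})\ \longmapsto\ \theta_{PH_n}\left(S^{T}\begin{bmatrix} D&0\\ 0&D\end{bmatrix}S,\ S^{-1}\mathbf{v}\right)\in PH_n,\qquad D=\mathrm{diag}(\mathbf{d}),$$ such that for every $(\mathbf{d},\mathbf{v})\in\Theta_{CH_n}$ the controllable Hamiltonian system $\theta_{CH_n}(\mathbf{d},\mathbf{v})$ and its port-Hamiltonian image $\varphi_S(\theta_{CH_n}(\mathbf{d},\mathbf{v}))$ are linked by a linear system morphism $f_S^{(\mathbf{d},\mathbf{v})}:\mathbb{R}^{2n}\rightarrow\mathbb{R}^{2n}$ from the state space of $\theta_{CH_n}(\mathbf{d},\mathbf{v})$ to the state space of $\varphi_S(\theta_{CH_n}(\mathbf{d},\mathbf{v}))$. **(ii)** Let $(Q,\mathbf{B})\in\Theta_{PH_n}$, and let $Q=S^{T}\begin{bmatrix} D&0\\ 0&D\end{bmatrix}S$ be a Williamson normal form decomposition of $Q$, where $S\in Sp(2n,\mathbb{R})$ and $D=\mathrm{diag}(\mathbf{d})$ with $\mathbf{d}\in\mathbb{R}^n$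 having positive entries. Put $\mathbf{v}=S\mathbf{B}$, so that $(\mathbf{d},\mathbf{v})\in\Theta_{OH_n}$. Then there exists an (explicit) linear system morphism $f^{(Q,\mathbf{B})}:\mathbb{R}^{2n}\rightarrow\mathbb{R}^{2n}$ from the state space of the port-Hamiltonian system $\theta_{PH_n}(Q,\mathbf{B})\in PH_n$ to the state space of the observable Hamiltonian system $\theta_{OH_n}(\mathbf{d},\mathbf{v})\in OH_n$.
   Context: **State-space systems and morphisms.** A (continuous-time) state-space system $(\mathcal{Z},F,h)$ with inputs in $\mathcal{U}$ and outputs in $\mathcal{Y}$ is given by $\dot{\mathbf{z}}=F(\mathbf{z},u)$, $y=h(\mathbf{z})$, where $F:\mathcal{Z}\times\mathcal{U}\to\mathcal{Z}$ and $h:\mathcal{Z}\to\mathcal{Y}$. Here $\mathcal{Z}=\mathbb{R}^{2n}$ and $\mathcal{U}=\mathcal{Y}=\mathbb{R}$. A map $f:\mathcal{Z}_1\to\mathcal{Z}_2$ is a *system morphism* between $(\mathcal{Z}_1,F_1,h_1)$ and $(\mathcal{Z}_2,F_2,h_2)$ if - (system equivariance) $f(F_1(\mathbf{z}_1,u))=F_2(f(\mathbf{z}_1),u)$ for all $\mathbf{z}_1\in\mathcal{Z}_1$, $u\in\mathcal{U}$; - (readout invariance) $h_1(\mathbf{z}_1)=h_2(f(\mathbf{z}_1))$ for all $\mathbf{z}_1\in\mathcal{Z}_1$. It is a *linear* system morphism if $f$ is moreover a linear map. **Symplectic notation.** $\mathbb{J}=\begin{bmatrix}0&\mathbb{I}_n\\-\mathbb{I}_n&0\end{bmatrix}$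 and $Sp(2n,\mathbb{R})=\{S\in\mathbb{M}_{2n} : S^T\mathbb{J}S=\mathbb{J}\}$, where $\mathbb{M}_{2n}$ is the set of real $2n\times 2n$ matrices. By Williamson's theorem, every symmetric positive-definite $Q\in\mathbb{M}_{2n}$ can be written as $Q=S^T\begin{bmatrix}D&0\\0&D\end{bmatrix}S$ with $S\in Sp(2n,\mathbb{R})$ and $D=\mathrm{diag}(\mathbf{d})$, a diagonal $n\times n$ matrix with positive diagonal entries $\mathbf{d}=(d_1,\dots,d_n)^T$; such an expression is called a Williamson normal form decomposition of $Q$. **Port-Hamiltonian systems in normal form.** $\Theta_{PH_n}=\{(Q,\mathbf{B}) : Q\in\mathbb{M}_{2n},\ Q=Q^T,\ Q>0,\ \mathbf{B}\in\mathbb{R}^{2n}\}$. For $(Q,\mathbf{B})\in\Theta_{PH_n}$, $\theta_{PH_n}(Q,\mathbf{B})$ is the state-space system on $\mathbb{R}^{2n}$ $$\dot{\mathbf{z}}=\mathbb{J}Q\mathbf{z}+\mathbf{B}u,\qquad y=\mathbf{B}^TQ\mathbf{z}.$$ $PH_n$ is the set of all such systems. **Controllable and observable Hamiltonian representations.** $\Theta_{CH_n}=\Theta_{OH_n}=\{(\mathbf{d},\mathbf{v}) : \mathbf{d}=(d_1,\dots,d_n)^T\in\mathbb{R}^n,\ d_i>0 \text{ for all } i,\ \mathbf{v}\in\mathbb{R}^{2n}\}$. For $(\mathbf{d},\mathbf{v})$ in this set: - Let $a_0,\dots,a_{2n-1}\in\mathbb{R}$ be the coefficients determined by the polynomial identity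 $\lambda^{2n}+\sum_{i=0}^{2n-1}a_i\lambda^i=(\lambda^2+d_1^2)(\lambda^2+d_2^2)\cdots(\lambda^2+d_n^2)$, and let $$g_1^{ctr}(\mathbf{d})=\begin{bmatrix}0&1&0&\dots&0\\0&0&1&\dots&0\\\vdots&\vdots&\ddots&\vdots&\vdots\\0&0&0&\dots&1\\-a_0&-a_1&-a_2&\dots&-a_{2n-1}\end{bmatrix}\in\mathbb{M}_{2n},\qquad g_1^{obs}(\mathbf{d})=g_1^{ctr}(\mathbf{d})^T.$$ - For $k=0,\dots,n-1$ let $c_{2k+1}=\mathbf{v}^T\begin{bmatrix}F_k&0\\0&F_k\end{bmatrix}\mathbf{v}$, where $F_k=\mathrm{diag}(f_1,\dots,f_n)$ with $$f_l=d_l\cdot\sum_{\substack{1\le j_1<\dots<j_k\le n\\ j_1,\dots,j_k\neq l}}\left(d_{j_1}d_{j_2}\cdots d_{j_k}\right)^2,\qquad l=1,\dots,n$$ (for $k=0$ the sum is the empty product, equal to $1$, so $f_l=d_l$). Let $$g_2^{ctr}(\mathbf{d},\mathbf{v})=\begin{bmatrix}0&c_{2n-1}&0&c_{2n-3}&\cdots&0&c_1\end{bmatrix}\in\mathbb{M}_{1,2n},\qquad g_2^{obs}(\mathbf{d},\mathbf{v})=g_2^{ctr}(\mathbf{d},\mathbf{v})^T.$$ The *controllable Hamiltonian representation* $\theta_{CH_n}(\mathbf{d},\mathbf{v})$ is the state-space system on $\mathbb{R}^{2n}$ $$\dot{\mathbf{s}}=g_1^{ctr}(\mathbf{d})\,\mathbf{s}+(0,0,\dots,0,1)^T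 u,\qquad y=g_2^{ctr}(\mathbf{d},\mathbf{v})\,\mathbf{s},$$ and the *observable Hamiltonian representation* $\theta_{OH_n}(\mathbf{d},\mathbf{v})$ is the state-space system on $\mathbb{R}^{2n}$ $$\dot{\mathbf{s}}=g_1^{obs}(\mathbf{d})\,\mathbf{s}+g_2^{obs}(\mathbf{d},\mathbf{v})\,u,\qquad y=(0,0,\dots,0,1)\,\mathbf{s}.$$ $CH_n$ and $OH_n$ denote the sets of all such systems. **Convention on $\varphi_S$.** In part (i), an element of the domain of $\varphi_S$ is understood to come with its parameter $(\mathbf{d},\mathbf{v})$, i.e. $\varphi_S$ is the assignment $(\mathbf{d},\mathbf{v})\mapsto\theta_{PH_n}(S^T\,\mathrm{diag}(D,D)\,S,\,S^{-1}\mathbf{v})$ on $\Theta_{CH_n}$. *)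

theory Defs
  imports
    "Jordan_Normal_Form.VS_Connect"
    "Jordan_Normal_Form.Gauss_Jordan_Elimination"
    "HOL-Library.FuncSet"
begin

text \<open>
  Throughout, \<open>\<real>\<^sup>m\<close> is \<open>carrier_vec m\<close> and the real \<open>m \<times> m\<close> matrices are \<open>carrier_mat m m\<close>.
  Indices start at 0, so \<open>d $ l\<close> is the entry \<open>d\<^sub>l\<^sub>+\<^sub>1\<close> of the usual notation.
\<close>

section \<open>State-space systems and morphisms\<close>

record ('z, 'u, 'y) state_space =
  states :: "'z set"
  dyn :: "'z \<Rightarrow> 'u \<Rightarrow> 'z"
  readout :: "'z \<Rightarrow> 'y"

definition state_space_system :: "('z, 'u, 'y) state_space \<Rightarrow> bool" where
  "state_space_system \<Sigma> \<longleftrightarrow> (\<forall>z\<in>states \<Sigma>. \<forall>u. dyn \<Sigma> z u \<in> states \<Sigma>)"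

definition system_morphism ::
  "('z1, 'u, 'y) state_space \<Rightarrow> ('z2, 'u, 'y) state_space \<Rightarrow> ('z1 \<Rightarrow> 'z2) \<Rightarrow> bool" where
  "system_morphism \<Sigma>1 \<Sigma>2 f \<longleftrightarrow>
     state_space_system \<Sigma>1 \<and> state_space_system \<Sigma>2 \<and>
     f \<in> states \<Sigma>1 \<rightarrow> states \<Sigma>2 \<and>
     (\<forall>z\<in>states \<Sigma>1. \<forall>u. f (dyn \<Sigma>1 z u) = dyn \<Sigma>2 (f z) u) \<and>
     (\<forall>z\<in>states \<Sigma>1. readout \<Sigma>1 z = readout \<Sigma>2 (f z))"

definition linear_system_morphism ::
  "nat \<Rightarrow> nat \<Rightarrow> (real vec, 'u, 'y) state_space \<Rightarrow> (real vec, 'u, 'y) state_space \<Rightarrow>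
   (real vec \<Rightarrow> real vec) \<Rightarrow> bool" where
  "linear_system_morphism m k \<Sigma>1 \<Sigma>2 f \<longleftrightarrow>
     states \<Sigma>1 = carrier_vec m \<and> states \<Sigma>2 = carrier_vec k \<and>
     system_morphism \<Sigma>1 \<Sigma>2 f \<and>
     linear_map class_ring (module_vec TYPE(real) m) (module_vec TYPE(real) k) f"

section \<open>Symplectic matrices and Williamson normal form\<close>

definition JJ :: "nat \<Rightarrow> real mat" where
  "JJ n = four_block_mat (0\<^sub>m n n) (1\<^sub>m n) (- 1\<^sub>m n) (0\<^sub>m n n)"

definition Sp :: "nat \<Rightarrow> real mat set" where
  "Sp n = {S \<in> carrier_mat (2 * n) (2 * n). transpose_mat S * JJ n * S = JJ n}"

text \<open>\<open>mat_inverse\<close> returns an option; its value is the inverse whenever the matrix is invertible.\<close>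

definition minv :: "real mat \<Rightarrow> real mat" where
  "minv S = the (mat_inverse S)"

definition diag2 :: "nat \<Rightarrow> real vec \<Rightarrow> real mat" where
  "diag2 n d = diag_block_mat [mat_diag n (\<lambda>i. d $ i), mat_diag n (\<lambda>i. d $ i)]"

definition pos_def_mat :: "nat \<Rightarrow> real mat \<Rightarrow> bool" where
  "pos_def_mat m Q \<longleftrightarrow> (\<forall>z\<in>carrier_vec m. z \<noteq> 0\<^sub>v m \<longrightarrow> z \<bullet> (Q *\<^sub>v z) > 0)"

definition williamson_decomposition :: "nat \<Rightarrow> real mat \<Rightarrow> real mat \<Rightarrow> real vec \<Rightarrow> bool" where
  "williamson_decomposition n Q S d \<longleftrightarrow>
     S \<in> Sp n \<and> d \<in> carrier_vec n \<and> (\<forall>i<n. d $ i > 0) \<and>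
     Q = transpose_mat S * diag2 n d * S"

section \<open>Port-Hamiltonian systems in normal form\<close>

definition Theta_PH :: "nat \<Rightarrow> (real mat \<times> real vec) set" where
  "Theta_PH n = {(Q, B). Q \<in> carrier_mat (2 * n) (2 * n) \<and> Q = transpose_mat Q \<and>
     pos_def_mat (2 * n) Q \<and> B \<in> carrier_vec (2 * n)}"

definition theta_PH :: "nat \<Rightarrow> real mat \<Rightarrow> real vec \<Rightarrow> (real vec, real, real) state_space" where
  "theta_PH n Q B =
     \<lparr> states = carrier_vec (2 * n),
       dyn = (\<lambda>z u. JJ n *\<^sub>v (Q *\<^sub>v z) + u \<cdot>\<^sub>v B),
       readout = (\<lambda>z. B \<bullet> (Q *\<^sub>v z)) \<rparr>"

definition PH :: "nat \<Rightarrow> (real vec, real, real) state_space set" where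
  "PH n = {theta_PH n Q B | Q B. (Q, B) \<in> Theta_PH n}"

section \<open>Controllable and observable Hamiltonian representations\<close>

definition Theta_CH :: "nat \<Rightarrow> (real vec \<times> real vec) set" where
  "Theta_CH n = {(d, v). d \<in> carrier_vec n \<and> (\<forall>i<n. d $ i > 0) \<and> v \<in> carrier_vec (2 * n)}"

definition Theta_OH :: "nat \<Rightarrow> (real vec \<times> real vec) set" where
  "Theta_OH n = Theta_CH n"

definition ham_poly :: "nat \<Rightarrow> real vec \<Rightarrow> real poly" where
  "ham_poly n d = (\<Prod>i<n. monom 1 2 + [:(d $ i)\<^sup>2:])"

definition a_coeff :: "nat \<Rightarrow> real vec \<Rightarrow> nat \<Rightarrow> real" where
  "a_coeff n d i = coeff (ham_poly n d) i"

definition g1_ctr :: "nat \<Rightarrow> real vec \<Rightarrow> real mat" where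
  "g1_ctr n d = mat (2 * n) (2 * n) (\<lambda>(i, j).
     if i = 2 * n - 1 then - a_coeff n d j
     else if j = i + 1 then 1 else 0)"

definition g1_obs :: "nat \<Rightarrow> real vec \<Rightarrow> real mat" where
  "g1_obs n d = transpose_mat (g1_ctr n d)"

text \<open>The tuples \<open>j\<^sub>1 < \<dots> < j\<^sub>k\<close> avoiding \<open>l\<close> are represented by the \<open>k\<close>-element sets avoiding \<open>l\<close>.\<close>

definition f_entry :: "nat \<Rightarrow> real vec \<Rightarrow> nat \<Rightarrow> nat \<Rightarrow> real" where
  "f_entry n d k l =
     d $ l * (\<Sum>J | J \<subseteq> {..<n} - {l} \<and> card J = k. (\<Prod>j\<in>J. d $ j)\<^sup>2)"

definition F_mat :: "nat \<Rightarrow> real vec \<Rightarrow> nat \<Rightarrow> real mat" where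
  "F_mat n d k = mat_diag n (f_entry n d k)"

text \<open>\<open>c_odd n d v k\<close> is the number \<open>c\<close> with subscript \<open>2k + 1\<close>.\<close>

definition c_odd :: "nat \<Rightarrow> real vec \<Rightarrow> real vec \<Rightarrow> nat \<Rightarrow> real" where
  "c_odd n d v k = v \<bullet> (diag_block_mat [F_mat n d k, F_mat n d k] *\<^sub>v v)"

text \<open>
  With 0-based columns, column \<open>j\<close> of the row \<open>[0, c\<^sub>2\<^sub>n\<^sub>-\<^sub>1, 0, c\<^sub>2\<^sub>n\<^sub>-\<^sub>3, \<dots>, 0, c\<^sub>1]\<close> is 0 for even \<open>j\<close>;
  for odd \<open>j\<close> it is \<open>c\<close> with subscript \<open>2n - j = 2k + 1\<close>, where \<open>k = (2n - 1 - j) / 2\<close>.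
\<close>

definition g2_ctr :: "nat \<Rightarrow> real vec \<Rightarrow> real vec \<Rightarrow> real mat" where
  "g2_ctr n d v = mat 1 (2 * n) (\<lambda>(_, j).
     if odd j then c_odd n d v ((2 * n - 1 - j) div 2) else 0)"

definition g2_obs :: "nat \<Rightarrow> real vec \<Rightarrow> real vec \<Rightarrow> real mat" where
  "g2_obs n d v = transpose_mat (g2_ctr n d v)"

definition theta_CH :: "nat \<Rightarrow> real vec \<Rightarrow> real vec \<Rightarrow> (real vec, real, real) state_space" where
  "theta_CH n d v =
     \<lparr> states = carrier_vec (2 * n),
       dyn = (\<lambda>s u. g1_ctr n d *\<^sub>v s + u \<cdot>\<^sub>v unit_vec (2 * n) (2 * n - 1)),
       readout = (\<lambda>s. row (g2_ctr n d v) 0 \<bullet> s) \<rparr>"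

definition theta_OH :: "nat \<Rightarrow> real vec \<Rightarrow> real vec \<Rightarrow> (real vec, real, real) state_space" where
  "theta_OH n d v =
     \<lparr> states = carrier_vec (2 * n),
       dyn = (\<lambda>s u. g1_obs n d *\<^sub>v s + u \<cdot>\<^sub>v col (g2_obs n d v) 0),
       readout = (\<lambda>s. unit_vec (2 * n) (2 * n - 1) \<bullet> s) \<rparr>"

definition OH :: "nat \<Rightarrow> (real vec, real, real) state_space set" where
  "OH n = {theta_OH n d v | d v. (d, v) \<in> Theta_OH n}"

text \<open>
  The image of a controllable Hamiltonian representation is a function of its parameter
  \<open>(d, v)\<close>, not of the system alone.
\<close>

definition phi_param :: "nat \<Rightarrow> real mat \<Rightarrow> real vec \<times> real vec \<Rightarrow> real mat \<times> real vec" where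
  "phi_param n S = (\<lambda>(d, v). (transpose_mat S * diag2 n d * S, minv S *\<^sub>v v))"

definition phi :: "nat \<Rightarrow> real mat \<Rightarrow> real vec \<times> real vec \<Rightarrow> (real vec, real, real) state_space" where
  "phi n S p = (case phi_param n S p of (Q, B) \<Rightarrow> theta_PH n Q B)"

section \<open>Consistency of the encodings\<close>

lemma ham_poly_monic:
  shows "degree (ham_poly n d) = 2 * n" and "coeff (ham_poly n d) (2 * n) = 1"
proof -
  have deg: "degree (monom 1 2 + [:c:] :: real poly) = 2" for c
    by (subst degree_add_eq_left) (auto simp: degree_monom_eq)
  have lc: "lead_coeff (monom 1 2 + [:c:] :: real poly) = 1" for c
    unfolding deg by (simp add: coeff_pCons split: nat.splits)
  have nz: "(monom 1 2 + [:c:] :: real poly) \<noteq> 0" for c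
    using deg[of c] by force
  show "degree (ham_poly n d) = 2 * n"
    unfolding ham_poly_def by (subst degree_prod_eq_sum_degree) (auto simp: nz deg)
  moreover have "lead_coeff (ham_poly n d) = 1"
    unfolding ham_poly_def lead_coeff_prod using lc by simp
  ultimately show "coeff (ham_poly n d) (2 * n) = 1" by simp
qed

lemma a_coeff_identity:
  "x ^ (2 * n) + (\<Sum>i<2 * n. a_coeff n d i * x ^ i) = (\<Prod>i<n. x\<^sup>2 + (d $ i)\<^sup>2)"
proof -
  have "(\<Prod>i<n. x\<^sup>2 + (d $ i)\<^sup>2) = poly (ham_poly n d) x"
    by (simp add: ham_poly_def poly_prod poly_monom)
  also have "\<dots> = (\<Sum>i\<le>2 * n. coeff (ham_poly n d) i * x ^ i)"
    by (simp add: poly_altdef ham_poly_monic)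
  also have "\<dots> = (\<Sum>i<2 * n. coeff (ham_poly n d) i * x ^ i) + x ^ (2 * n)"
    by (simp add: lessThan_Suc_atMost[symmetric] ham_poly_monic)
  finally show ?thesis by (simp add: a_coeff_def)
qed

lemma JJ_carrier [simp]: "JJ n \<in> carrier_mat (2 * n) (2 * n)"
  by (auto simp: JJ_def mult_2)

lemma JJ_square: "JJ n * JJ n = - 1\<^sub>m (2 * n)"
  unfolding JJ_def
  by (subst mult_four_block_mat[of _ n n _ n _ n]) (auto intro!: eq_matI simp: mult_2)

lemma minv_Sp:
  assumes S: "S \<in> Sp n"
  shows "minv S \<in> carrier_mat (2 * n) (2 * n)"
    and "minv S * S = 1\<^sub>m (2 * n)" and "S * minv S = 1\<^sub>m (2 * n)"
proof -
  let ?N = "2 * n"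
  have Sc: "S \<in> carrier_mat ?N ?N" and eq: "transpose_mat S * JJ n * S = JJ n"
    using S by (auto simp: Sp_def)
  let ?T = "- (JJ n * (transpose_mat S * JJ n))"
  have Tc: "?T \<in> carrier_mat ?N ?N"
    using Sc by (intro uminus_carrier_mat mult_carrier_mat[of _ ?N ?N] JJ_carrier) auto
  have "?T * S = - (JJ n * (transpose_mat S * JJ n * S))"
    using Sc carrier_matD[OF JJ_carrier[of n]]
    by (simp add: assoc_mult_mat[of _ ?N ?N _ ?N _ ?N])
  also have "\<dots> = 1\<^sub>m ?N" unfolding eq JJ_square by simp
  finally have TS: "?T * S = 1\<^sub>m ?N" .
  have ST: "S * ?T = 1\<^sub>m ?N" using mat_mult_left_right_inverse[OF Tc Sc TS] .
  have "S \<in> Units (ring_mat TYPE(real) ?N ())"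
    using Sc Tc TS ST unfolding Units_def ring_mat_def by auto
  then obtain B where B: "mat_inverse S = Some B"
    using mat_inverse(1)[OF Sc, where b = "()"] by (cases "mat_inverse S") auto
  from mat_inverse(2)[OF Sc B] B
  show "minv S \<in> carrier_mat ?N ?N" "minv S * S = 1\<^sub>m ?N" "S * minv S = 1\<^sub>m ?N"
    by (auto simp: minv_def)
qed

end

theory Submission
  imports Defs
begin

text \<open>
  Both parts come from a single intertwining matrix. A linear morphism out of the controllable
  system into \<open>z' = A z + b u\<close>, \<open>y = c \<bullet> z\<close> is forced by the companion form: its last column is
  \<open>b\<close>, and the others follow downwards from \<open>K\<^sub>j\<^sub>-\<^sub>1 = A K\<^sub>j + a\<^sub>j b\<close>, so \<open>K\<^sub>j\<close> is \<open>p\<^sub>j(A) b\<close> with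
  \<open>p\<^sub>j\<close> the quotient of \<open>\<Prod>\<^sub>i (X\<^sup>2 + d\<^sub>i\<^sup>2)\<close> by \<open>X\<^sup>j\<^sup>+\<^sup>1\<close>.

  For \<open>A = J \<Delta>\<close> with \<open>\<Delta> = diag(D, D)\<close> everything is explicit, because \<open>A\<^sup>2 = - \<Delta>\<^sup>2\<close> is diagonal.
  For odd \<open>j\<close>, synthetic division of \<open>\<Prod>\<^sub>i (X\<^sup>2 + d\<^sub>i\<^sup>2)\<close> by \<open>X\<^sup>2 + d\<^sub>l\<^sup>2\<close> shows that \<open>p\<^sub>j(A)\<close> acts on
  the coordinates \<open>l\<close> and \<open>l + n\<close> as the coefficient of \<open>X\<^sup>j\<^sup>-\<^sup>1\<close> in
  \<open>h\<^sub>l = \<Prod>\<^sub>i\<^sub>\<noteq>\<^sub>l (X\<^sup>2 + d\<^sub>i\<^sup>2)\<close>; for even \<open>j\<close> one has \<open>p\<^sub>j(A) = A p\<^sub>j\<^sub>+\<^sub>1(A)\<close>. With these columns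
  (\<open>chain_matrix\<close>) the equivariance is the coefficient identity
  \<open>a\<^sub>j = h\<^sub>l\<^sub>,\<^sub>j\<^sub>-\<^sub>2 + d\<^sub>l\<^sup>2 h\<^sub>l\<^sub>,\<^sub>j\<close> (\<open>a_coeff_cofactor\<close>). The readout
  agrees because the coefficients of \<open>h\<^sub>l\<close> are elementary symmetric in the \<open>d\<^sub>i\<^sup>2\<close>, so that with
  the factor \<open>d\<^sub>l\<close> from \<open>\<Delta>\<close> they become the entries of \<open>F\<^sub>k\<close>; the even columns contribute nothing by
  skew-symmetry of \<open>\<Delta> J \<Delta>\<close>.

  A general symplectic \<open>S\<close> only changes coordinates: \<open>J S\<^sup>T = S\<^sup>-\<^sup>1 J\<close> turns \<open>J S\<^sup>T \<Delta> S\<close> into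
  \<open>S\<^sup>-\<^sup>1 (J \<Delta>) S\<close>, so \<open>S\<^sup>-\<^sup>1 K\<close> proves part (i) (\<open>morphism_matrix_symplectic_change\<close>).

  Part (ii) is dual to part (i). Transposing \<open>J Q K = K G\<close>, with \<open>G\<close> the companion matrix, gives
  \<open>K\<^sup>T Q J = - G\<^sup>T K\<^sup>T\<close>. Since the characteristic polynomial is even, \<open>G\<close> anticommutes with the
  diagonal matrix \<open>E\<close> of alternating signs, and this absorbs the minus sign: \<open>E K\<^sup>T Q\<close>
  intertwines \<open>J Q\<close> with \<open>G\<^sup>T\<close> (\<open>morphism_matrix_dual\<close>).
\<close>

section \<open>Linear systems in coordinates\<close>

text \<open>
  Agreement is required only on vectors of dimension \<open>m\<close>; as functions on all vectors the dynamics
  of a system and \<open>A *\<^sub>v z + u \<cdot>\<^sub>v b\<close> need not coincide.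
\<close>

definition represents ::
  "nat \<Rightarrow> (real vec, real, real) state_space \<Rightarrow> real mat \<Rightarrow> real vec \<Rightarrow> real vec \<Rightarrow> bool" where
  "represents m \<Sigma> A b c \<longleftrightarrow>
     A \<in> carrier_mat m m \<and> b \<in> carrier_vec m \<and> c \<in> carrier_vec m \<and>
     states \<Sigma> = carrier_vec m \<and>
     (\<forall>z\<in>carrier_vec m. \<forall>u. dyn \<Sigma> z u = A *\<^sub>v z + u \<cdot>\<^sub>v b) \<and>
     (\<forall>z\<in>carrier_vec m. readout \<Sigma> z = c \<bullet> z)"

definition morphism_matrix ::
  "nat \<Rightarrow> real mat \<times> real vec \<times> real vec \<Rightarrow> real mat \<times> real vec \<times> real vec \<Rightarrow> real mat \<Rightarrow> bool" where
  "morphism_matrix m = (\<lambda>(A1, b1, c1) (A2, b2, c2) K.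
     K \<in> carrier_mat m m \<and> K * A1 = A2 * K \<and> K *\<^sub>v b1 = b2 \<and> transpose_mat K *\<^sub>v c2 = c1)"

lemma linear_map_mult_mat_vec:
  assumes K: "K \<in> carrier_mat k m"
  shows "linear_map class_ring (module_vec TYPE(real) m) (module_vec TYPE(real) k) (\<lambda>z. K *\<^sub>v z)"
proof -
  have V: "vectorspace class_ring (module_vec TYPE(real) j)" for j
    by (rule vec_vs)
  have "(\<lambda>z. K *\<^sub>v z) \<in>
      LinearCombinations.module_hom class_ring (module_vec TYPE(real) m) (module_vec TYPE(real) k)"
    using K unfolding LinearCombinations.module_hom_def
    by (simp add: module_vec_simps mult_mat_vec_carrier[of _ k m]
        mult_add_distrib_mat_vec[of _ k m] mult_mat_vec[of _ k m])
  then show ?thesis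
    using V[of m] V[of k]
    by (simp add: linear_map_def mod_hom_def mod_hom_axioms_def vectorspace_def)
qed

lemma linear_system_morphism_of_matrix:
  assumes R1: "represents m \<Sigma>1 A1 b1 c1" and R2: "represents m \<Sigma>2 A2 b2 c2"
    and K: "morphism_matrix m (A1, b1, c1) (A2, b2, c2) K"
  shows "linear_system_morphism m m \<Sigma>1 \<Sigma>2 (\<lambda>z. K *\<^sub>v z)"
proof -
  have [simp]: "A1 \<in> carrier_mat m m" "A2 \<in> carrier_mat m m" "K \<in> carrier_mat m m"
    "b1 \<in> carrier_vec m" "b2 \<in> carrier_vec m" "c1 \<in> carrier_vec m" "c2 \<in> carrier_vec m"
    "states \<Sigma>1 = carrier_vec m" "states \<Sigma>2 = carrier_vec m"
    using R1 R2 K by (auto simp: represents_def morphism_matrix_def)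
  have KA: "K * A1 = A2 * K" and Kb: "K *\<^sub>v b1 = b2" and Kc: "transpose_mat K *\<^sub>v c2 = c1"
    using K by (auto simp: morphism_matrix_def)
  have [simp]: "A1 *\<^sub>v z \<in> carrier_vec m" "K *\<^sub>v z \<in> carrier_vec m" "A2 *\<^sub>v z \<in> carrier_vec m"
    if "z \<in> carrier_vec m" for z using that by (simp_all add: mult_mat_vec_carrier[of _ m m])
  have D1: "dyn \<Sigma>1 z u = A1 *\<^sub>v z + u \<cdot>\<^sub>v b1" and D2: "dyn \<Sigma>2 z u = A2 *\<^sub>v z + u \<cdot>\<^sub>v b2"
    and O1: "readout \<Sigma>1 z = c1 \<bullet> z" and O2: "readout \<Sigma>2 z = c2 \<bullet> z"
    if "z \<in> carrier_vec m" for z u using R1 R2 that unfolding represents_def by blast+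
  have dyn: "K *\<^sub>v (dyn \<Sigma>1 z u) = dyn \<Sigma>2 (K *\<^sub>v z) u" if z: "z \<in> carrier_vec m" for z u
  proof -
    have "K *\<^sub>v (dyn \<Sigma>1 z u) = K *\<^sub>v (A1 *\<^sub>v z) + u \<cdot>\<^sub>v (K *\<^sub>v b1)"
      using z by (simp add: D1 mult_add_distrib_mat_vec[of _ m m] mult_mat_vec[of _ m m])
    also have "K *\<^sub>v (A1 *\<^sub>v z) = (A2 * K) *\<^sub>v z"
      using z by (simp flip: KA add: assoc_mult_mat_vec[of _ m m _ m])
    also have "\<dots> = A2 *\<^sub>v (K *\<^sub>v z)"
      using z by (simp add: assoc_mult_mat_vec[of _ m m _ m])
    finally show ?thesis using z by (simp add: D2 Kb)
  qed
  have out: "readout \<Sigma>1 z = readout \<Sigma>2 (K *\<^sub>v z)" if z: "z \<in> carrier_vec m" for z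
    using z transpose_vec_mult_scalar[of K m m z c2] by (simp add: O1 O2 Kc)
  show ?thesis
    unfolding linear_system_morphism_def system_morphism_def state_space_system_def
    using linear_map_mult_mat_vec[of K m m] dyn out by (simp add: D1 D2)
qed

section \<open>Matrices of the three systems\<close>

lemma g1_ctr_carrier [simp]: "g1_ctr n d \<in> carrier_mat (2 * n) (2 * n)"
  by (simp add: g1_ctr_def)

lemma row_g2_ctr_carrier [simp]: "row (g2_ctr n d v) 0 \<in> carrier_vec (2 * n)"
  unfolding carrier_vec_def by (simp add: g2_ctr_def)

lemma represents_theta_CH:
  "represents (2 * n) (theta_CH n d v)
     (g1_ctr n d) (unit_vec (2 * n) (2 * n - 1)) (row (g2_ctr n d v) 0)"
  by (simp add: represents_def theta_CH_def)

lemma represents_theta_OH: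
  "represents (2 * n) (theta_OH n d v)
     (transpose_mat (g1_ctr n d)) (row (g2_ctr n d v) 0) (unit_vec (2 * n) (2 * n - 1))"
proof -
  have "col (g2_obs n d v) 0 = row (g2_ctr n d v) 0"
    unfolding g2_obs_def by (rule col_transpose) (simp add: g2_ctr_def)
  then show ?thesis by (simp add: represents_def theta_OH_def g1_obs_def)
qed

lemma represents_theta_PH:
  assumes Q: "Q \<in> carrier_mat (2 * n) (2 * n)" "transpose_mat Q = Q"
    and B: "B \<in> carrier_vec (2 * n)"
  shows "represents (2 * n) (theta_PH n Q B) (JJ n * Q) B (Q *\<^sub>v B)"
proof -
  have "(Q *\<^sub>v B) \<bullet> z = B \<bullet> (Q *\<^sub>v z)" if "z \<in> carrier_vec (2 * n)" for z
    using transpose_vec_mult_scalar[OF Q(1) that B] Q(2) by simp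
  then show ?thesis
    using Q B by (simp add: represents_def theta_PH_def mult_carrier_mat[of _ "2*n" "2*n"]
        assoc_mult_mat_vec[of _ "2*n" "2*n" _ "2*n"] mult_mat_vec_carrier[of _ "2*n" "2*n"])
qed

lemma diag_pair_carrier [simp]:
  "diag_block_mat [mat_diag n f, mat_diag n f] \<in> carrier_mat (2 * n) (2 * n)"
  by (auto simp: mat_diag_def Let_def)

text \<open>
  The coordinates \<open>l\<close> and \<open>l + n\<close> carry the same frequency \<open>d\<^sub>l\<close>; \<open>i mod n\<close> is therefore the
  frequency index of the coordinate \<open>i\<close>.
\<close>

lemma mod_half:
  assumes "i < 2 * n"
  shows "i mod n = (if i < n then i else i - (n::nat))"
  using assms by (auto simp: mod_if)

lemma diag_pair_mult_vec:
  assumes z: "z \<in> carrier_vec (2 * n)" and i: "i < 2 * n"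
  shows "(diag_block_mat [mat_diag n f, mat_diag n f] *\<^sub>v z) $ i = f (i mod n) * z $ i"
proof -
  have entry: "diag_block_mat [mat_diag n f, mat_diag n f] $$ (i, j) =
      (if i = j then f (i mod n) else 0)" if "j < 2 * n" for j
    using i that by (auto simp: mat_diag_def Let_def mod_half)
  have "(diag_block_mat [mat_diag n f, mat_diag n f] *\<^sub>v z) $ i =
      (\<Sum>j\<in>{0..<2 * n}. diag_block_mat [mat_diag n f, mat_diag n f] $$ (i, j) * z $ j)"
    using z i carrier_matD[OF diag_pair_carrier[of n f]]
    by (auto simp: scalar_prod_def simp del: diag_block_mat.simps)
  also have "\<dots> = (\<Sum>j\<in>{0..<2 * n}. if i = j then f (i mod n) * z $ i else 0)"
    by (intro sum.cong) (auto simp: entry simp del: diag_block_mat.simps)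
  also have "\<dots> = f (i mod n) * z $ i"
    using i by simp
  finally show ?thesis .
qed

lemma diag2_carrier [simp]: "diag2 n d \<in> carrier_mat (2 * n) (2 * n)"
  unfolding diag2_def by (rule diag_pair_carrier)

lemma diag2_mult_vec:
  assumes "z \<in> carrier_vec (2 * n)" "i < 2 * n"
  shows "(diag2 n d *\<^sub>v z) $ i = d $ (i mod n) * z $ i"
  unfolding diag2_def using assms by (rule diag_pair_mult_vec)

lemma transpose_diag2: "transpose_mat (diag2 n d) = diag2 n d"
  by (rule eq_matI) (auto simp: diag2_def mat_diag_def Let_def)

lemma JJ_mult_vec:
  assumes z: "z \<in> carrier_vec (2 * n)" and i: "i < 2 * n"
  shows "(JJ n *\<^sub>v z) $ i = (if i < n then z $ (i + n) else - z $ (i - n))"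
proof -
  have entry: "JJ n $$ (i, j) = (if i < n then if j = i + n then 1 else 0
      else if j = i - n then - 1 else 0)" if "j < 2 * n" for j
    using i that by (auto simp: JJ_def)
  have "(JJ n *\<^sub>v z) $ i = (\<Sum>j\<in>{0..<2 * n}. JJ n $$ (i, j) * z $ j)"
    using z i carrier_matD[OF JJ_carrier[of n]] by (auto simp: scalar_prod_def)
  also have "\<dots> = (\<Sum>j\<in>{0..<2 * n}. if j = (if i < n then i + n else i - n)
      then if i < n then z $ (i + n) else - z $ (i - n) else 0)"
    by (intro sum.cong) (auto simp: entry)
  also have "\<dots> = (if i < n then z $ (i + n) else - z $ (i - n))"
    using i by auto
  finally show ?thesis .
qed

lemma transpose_JJ: "transpose_mat (JJ n) = - JJ n"
  by (rule eq_matI) (auto simp: JJ_def)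

text \<open>
  Column \<open>j\<close> of the companion matrix is \<open>e\<^sub>j\<^sub>-\<^sub>1 - a\<^sub>j e\<^sub>2\<^sub>n\<^sub>-\<^sub>1\<close> (without the first term for
  \<open>j = 0\<close>), so equivariance of \<open>K\<close> is a recursion between neighbouring columns of \<open>K\<close>.
\<close>

lemma mult_g1_ctr_entry:
  assumes K: "K \<in> carrier_mat (2 * n) (2 * n)" and i: "i < 2 * n" and j: "j < 2 * n"
  shows "(K * g1_ctr n d) $$ (i, j) =
    (if j = 0 then 0 else K $$ (i, j - 1)) - a_coeff n d j * K $$ (i, 2 * n - 1)"
proof -
  have "(K * g1_ctr n d) $$ (i, j) =
      (\<Sum>k\<in>{0..<2 * n}. K $$ (i, k) * g1_ctr n d $$ (k, j))"
    using K i j carrier_matD[OF g1_ctr_carrier[of n d]] by (auto simp: scalar_prod_def)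
  also have "{0..<2 * n} = insert (2 * n - 1) {0..<2 * n - 1}"
    using i by auto
  also have "(\<Sum>k\<in>\<dots>. K $$ (i, k) * g1_ctr n d $$ (k, j)) =
      - a_coeff n d j * K $$ (i, 2 * n - 1) +
      (\<Sum>k\<in>{0..<2 * n - 1}. K $$ (i, k) * g1_ctr n d $$ (k, j))"
    using j by (simp add: g1_ctr_def)
  also have "(\<Sum>k\<in>{0..<2 * n - 1}. K $$ (i, k) * g1_ctr n d $$ (k, j)) =
      (\<Sum>k\<in>{0..<2 * n - 1}. if j = Suc k then K $$ (i, k) else 0)"
    using j by (intro sum.cong) (auto simp: g1_ctr_def)
  also have "\<dots> = (if j = 0 then 0 else K $$ (i, j - 1))"
    using j by (cases j) auto
  finally show ?thesis by simp
qed

section \<open>Products of even quadratic polynomials\<close>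

text \<open>
  Expanding the product, the choice of the constants \<open>c i\<close> for \<open>i \<in> J\<close> and of \<open>X\<^sup>2\<close> elsewhere
  contributes to degree \<open>2 * (card I - card J)\<close>: the coefficients are the elementary symmetric
  sums, and odd degrees do not occur.
\<close>

lemma coeff_prod_even_quadratics:
  fixes c :: "'i \<Rightarrow> 'a :: comm_semiring_1"
  assumes I: "finite I"
  shows "coeff (\<Prod>i\<in>I. monom 1 2 + [:c i:]) j =
    (\<Sum>J | J \<subseteq> I \<and> j = 2 * (card I - card J). \<Prod>i\<in>J. c i)"
proof -
  have const: "(\<Prod>i\<in>J. [:c i:]) = [:\<Prod>i\<in>J. c i:]" for J
    by (induction J rule: infinite_finite_induct) (auto simp: one_pCons mult.commute)
  have "(\<Prod>i\<in>I. monom 1 2 + [:c i:]) = (\<Prod>i\<in>I. [:c i:] + monom 1 2)"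
    by (simp add: add.commute)
  also have "\<dots> = (\<Sum>J\<in>Pow I. [:\<Prod>i\<in>J. c i:] * monom 1 2 ^ card (I - J))"
    by (simp add: prod_add[OF I] const)
  also have "\<dots> = (\<Sum>J\<in>Pow I. monom (\<Prod>i\<in>J. c i) (2 * (card I - card J)))"
    using I by (intro sum.cong)
      (auto simp: monom_power card_Diff_subset finite_subset smult_monom)
  finally have "coeff (\<Prod>i\<in>I. monom 1 2 + [:c i:]) j =
      (\<Sum>J\<in>Pow I. if 2 * (card I - card J) = j then \<Prod>i\<in>J. c i else 0)"
    by (simp add: coeff_sum)
  also have "\<dots> = (\<Sum>J\<in>{J\<in>Pow I. 2 * (card I - card J) = j}. \<Prod>i\<in>J. c i)"
    using I by (intro sum.inter_filter[symmetric]) auto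
  finally show ?thesis by (simp add: eq_commute[of j])
qed

definition cofactor_poly :: "nat \<Rightarrow> real vec \<Rightarrow> nat \<Rightarrow> real poly" where
  "cofactor_poly n d l = (\<Prod>i\<in>{..<n} - {l}. monom 1 2 + [:(d $ i)\<^sup>2:])"

lemma ham_poly_cofactor:
  assumes "l < n"
  shows "ham_poly n d = (monom 1 2 + [:(d $ l)\<^sup>2:]) * cofactor_poly n d l"
  unfolding ham_poly_def cofactor_poly_def using assms by (intro prod.remove) auto

lemma a_coeff_cofactor:
  assumes "l < n"
  shows "a_coeff n d j = (if j < 2 then 0 else coeff (cofactor_poly n d l) (j - 2))
    + (d $ l)\<^sup>2 * coeff (cofactor_poly n d l) j"
  unfolding a_coeff_def ham_poly_cofactor[OF assms]
  by (simp add: distrib_right coeff_monom_mult)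

text \<open>
  The link with \<open>F\<^sub>k\<close>: the tuples avoiding \<open>l\<close> in its definition are the choices of constants
  in the product without the factor of index \<open>l\<close>.
\<close>

lemma coeff_cofactor_poly_even:
  assumes l: "l < n" and k: "k < n"
  shows "d $ l * coeff (cofactor_poly n d l) (2 * (n - 1 - k)) = f_entry n d k l"
proof -
  have "(J \<subseteq> {..<n} - {l} \<and> 2 * (n - 1 - k) = 2 * (card ({..<n} - {l}) - card J)) \<longleftrightarrow>
      (J \<subseteq> {..<n} - {l} \<and> card J = k)" for J
    using k l card_mono[of "{..<n} - {l}" J] by auto
  then show ?thesis
    by (simp add: cofactor_poly_def f_entry_def coeff_prod_even_quadratics prod_power_distrib
        del: mult_cancel1)
qed

lemma coeff_cofactor_poly_top:
  assumes l: "l < n"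
  shows "coeff (cofactor_poly n d l) (2 * n - 2) = 1"
proof -
  have "(J \<subseteq> {..<n} - {l} \<and> 2 * n - 2 = 2 * (card ({..<n} - {l}) - card J)) \<longleftrightarrow> J = {}" for J
  proof (cases "J \<subseteq> {..<n} - {l}")
    case True
    then have "finite J" "card J \<le> n - 1"
      using l card_mono[of "{..<n} - {l}" J] by (auto intro: finite_subset)
    moreover have "2 * n - 2 = 2 * (n - 1 - c) \<longleftrightarrow> c = 0" if "c \<le> n - 1" for c :: nat
      using that by (cases n) auto
    ultimately show ?thesis using l True by simp
  qed auto
  then show ?thesis
    by (simp add: cofactor_poly_def coeff_prod_even_quadratics)
qed

lemma a_coeff_odd:
  assumes "odd j"
  shows "a_coeff n d j = 0"
  using assms by (auto simp: a_coeff_def ham_poly_def coeff_prod_even_quadratics intro!: sum.neutral)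

section \<open>The morphism for a Hamiltonian in normal form\<close>

text \<open>
  Column \<open>j\<close> is \<open>p\<^sub>j(J \<Delta>) v\<close>, where \<open>p\<^sub>j\<close> is the quotient of \<open>ham_poly n d\<close> by \<open>X\<^sup>j\<^sup>+\<^sup>1\<close>. The even
  columns are \<open>J \<Delta>\<close> applied to the following odd column; \<open>J \<Delta>\<close> commutes with the coefficients of
  the cofactors because it preserves frequencies.
\<close>

definition chain_matrix :: "nat \<Rightarrow> real vec \<Rightarrow> real vec \<Rightarrow> real mat" where
  "chain_matrix n d v = mat (2 * n) (2 * n) (\<lambda>(i, j).
     if odd j then coeff (cofactor_poly n d (i mod n)) (j - 1) * v $ i
     else coeff (cofactor_poly n d (i mod n)) j * (JJ n *\<^sub>v (diag2 n d *\<^sub>v v)) $ i)"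

lemma chain_matrix_carrier [simp]: "chain_matrix n d v \<in> carrier_mat (2 * n) (2 * n)"
  by (simp add: chain_matrix_def)

lemma JJ_diag2_mult_vec:
  assumes z: "z \<in> carrier_vec (2 * n)" and i: "i < 2 * n"
  shows "(JJ n *\<^sub>v (diag2 n d *\<^sub>v z)) $ i =
    (if i < n then d $ i * z $ (i + n) else - (d $ (i - n) * z $ (i - n)))"
  using z i
  by (simp add: JJ_mult_vec diag2_mult_vec mult_mat_vec_carrier[of _ "2 * n" "2 * n"] mod_half)

lemma chain_matrix_equivariant:
  assumes v: "v \<in> carrier_vec (2 * n)"
  shows "chain_matrix n d v * g1_ctr n d = JJ n * diag2 n d * chain_matrix n d v"
proof (rule eq_matI)
  let ?K = "chain_matrix n d v"
  show "dim_row (?K * g1_ctr n d) = dim_row (JJ n * diag2 n d * ?K)"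
    using carrier_matD[OF JJ_carrier[of n]] by (simp add: chain_matrix_def)
  show "dim_col (?K * g1_ctr n d) = dim_col (JJ n * diag2 n d * ?K)"
    by (simp add: chain_matrix_def g1_ctr_def)
  fix i j
  assume "i < dim_row (JJ n * diag2 n d * ?K)" "j < dim_col (JJ n * diag2 n d * ?K)"
  then have i: "i < 2 * n" and j: "j < 2 * n"
    using carrier_matD[OF JJ_carrier[of n]] by (auto simp: chain_matrix_def)
  let ?h = "coeff (cofactor_poly n d (i mod n))"
  have l: "i mod n < n" using i by (cases n) auto
  \<comment> \<open>the cofactor is monic of degree \<open>2n - 2\<close>, so the recursion starts from \<open>v\<close>\<close>
  have last: "?K $$ (i, 2 * n - 1) = v $ i"
    using i coeff_cofactor_poly_top[OF l, of d] by (simp add: chain_matrix_def flip: numeral_2_eq_2)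
  have col: "col ?K j \<in> carrier_vec (2 * n)"
    using col_carrier_vec[OF j chain_matrix_carrier] .
  have "(JJ n * diag2 n d * ?K) $$ (i, j) = ((JJ n * diag2 n d) *\<^sub>v col ?K j) $ i"
    using i j carrier_matD[OF JJ_carrier[of n]] by (simp add: chain_matrix_def)
  also have "\<dots> = (JJ n *\<^sub>v (diag2 n d *\<^sub>v col ?K j)) $ i"
    by (simp only: assoc_mult_mat_vec[OF JJ_carrier diag2_carrier col])
  also have "\<dots> = (if i < n then d $ i * ?K $$ (i + n, j) else - (d $ (i - n) * ?K $$ (i - n, j)))"
    unfolding JJ_diag2_mult_vec[OF col i]
    using i j carrier_matD[OF chain_matrix_carrier[of n d v]] by simp
  \<comment> \<open>applying \<open>J \<Delta>\<close> twice returns to the coordinate \<open>i\<close> with the factor \<open>- d\<^sub>l\<^sup>2\<close>\<close>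
  also have "\<dots> = (if odd j then ?h (j - 1) * (JJ n *\<^sub>v (diag2 n d *\<^sub>v v)) $ i
      else - (d $ (i mod n))\<^sup>2 * ?h j * v $ i)"
    using i j v by (cases "i < n")
      (auto simp: chain_matrix_def JJ_diag2_mult_vec mod_half power2_eq_square)
  also have "\<dots> = (if j = 0 then 0 else ?K $$ (i, j - 1)) - a_coeff n d j * ?K $$ (i, 2 * n - 1)"
  proof (cases "odd j")
    case True
    then show ?thesis using i j by (auto simp: a_coeff_odd chain_matrix_def elim: oddE)
  next
    case False
    have "a_coeff n d j = (if j = 0 then 0 else ?h (j - 2)) + (d $ (i mod n))\<^sup>2 * ?h j"
      using a_coeff_cofactor[OF l, of d j] False by (cases "j = 1") auto
    moreover have "j = 0 \<or> ?K $$ (i, j - 1) = ?h (j - 2) * v $ i"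
      using i j False by (auto simp: chain_matrix_def elim!: evenE simp flip: numeral_2_eq_2)
    ultimately show ?thesis using False unfolding last by (auto simp: algebra_simps)
  qed
  also have "\<dots> = (?K * g1_ctr n d) $$ (i, j)"
    using i j by (simp add: mult_g1_ctr_entry)
  finally show "(?K * g1_ctr n d) $$ (i, j) = (JJ n * diag2 n d * ?K) $$ (i, j)" ..
qed

lemma chain_matrix_last_col:
  assumes v: "v \<in> carrier_vec (2 * n)"
  shows "chain_matrix n d v *\<^sub>v unit_vec (2 * n) (2 * n - 1) = v"
proof (cases "n = 0")
  case True
  with v show ?thesis by (auto simp: chain_matrix_def)
next
  case False
  have "chain_matrix n d v *\<^sub>v unit_vec (2 * n) (2 * n - 1) = col (chain_matrix n d v) (2 * n - 1)"
    using False by (intro eq_vecI) (simp_all add: chain_matrix_def)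
  also have "\<dots> = v"
  proof (rule eq_vecI)
    fix i assume "i < dim_vec v"
    then have i: "i < 2 * n" using v by auto
    have "i mod n < n" using False by simp
    from coeff_cofactor_poly_top[OF this, of d] 
    show "col (chain_matrix n d v) (2 * n - 1) $ i = v $ i"
      using i by (simp add: chain_matrix_def flip: numeral_2_eq_2)
  qed (use v in \<open>auto simp: chain_matrix_def\<close>)
  finally show ?thesis .
qed

lemma c_odd_sum:
  assumes v: "v \<in> carrier_vec (2 * n)"
  shows "c_odd n d v k = (\<Sum>i\<in>{0..<2 * n}. f_entry n d k (i mod n) * (v $ i)\<^sup>2)"
proof -
  have "c_odd n d v k = (\<Sum>i\<in>{0..<2 * n}.
      v $ i * (diag_block_mat [F_mat n d k, F_mat n d k] *\<^sub>v v) $ i)"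
    using carrier_matD[OF diag_pair_carrier[of n "f_entry n d k"]]
    unfolding c_odd_def F_mat_def scalar_prod_def[of v] by (simp del: diag_block_mat.simps)
  also have "\<dots> = (\<Sum>i\<in>{0..<2 * n}. f_entry n d k (i mod n) * (v $ i)\<^sup>2)"
    using v by (intro sum.cong refl)
      (simp add: F_mat_def diag_pair_mult_vec power2_eq_square del: diag_block_mat.simps)
  finally show ?thesis .
qed

lemma sum_two_halves:
  "(\<Sum>i\<in>{0..<2 * n}. g i) = (\<Sum>i\<in>{0..<n}. g i + g (i + n :: nat) :: 'a :: comm_monoid_add)"
proof -
  have "(\<Sum>i\<in>{0..<2 * n}. g i) = (\<Sum>i\<in>{0..<n}. g i) + (\<Sum>i\<in>{0 + n..<n + n}. g i)"
    by (simp add: sum.atLeastLessThan_concat mult_2)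
  also have "(\<Sum>i\<in>{0 + n..<n + n}. g i) = (\<Sum>i\<in>{0..<n}. g (i + n))"
    by (rule sum.shift_bounds_nat_ivl)
  finally show ?thesis by (simp add: sum.distrib)
qed

text \<open>
  In an odd column each entry contributes a term of the quadratic form of \<open>F\<^sub>k\<close> in \<open>v\<close>. In an even
  column the contributions of the coordinates \<open>l\<close> and \<open>l + n\<close> cancel, which is why the two halves
  of the sum are paired.
\<close>

lemma chain_matrix_readout:
  assumes v: "v \<in> carrier_vec (2 * n)"
  shows "transpose_mat (chain_matrix n d v) *\<^sub>v (diag2 n d *\<^sub>v v) = row (g2_ctr n d v) 0"
proof (rule eq_vecI)
  let ?K = "chain_matrix n d v"
  show "dim_vec (transpose_mat ?K *\<^sub>v (diag2 n d *\<^sub>v v)) = dim_vec (row (g2_ctr n d v) 0)"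
    by (simp add: chain_matrix_def g2_ctr_def)
  fix j assume "j < dim_vec (row (g2_ctr n d v) 0)"
  then have j: "j < 2 * n" by (simp add: g2_ctr_def)
  have "(transpose_mat ?K *\<^sub>v (diag2 n d *\<^sub>v v)) $ j =
      (\<Sum>i\<in>{0..<2 * n}. ?K $$ (i, j) * (diag2 n d *\<^sub>v v) $ i)"
    using j carrier_matD[OF diag2_carrier[of n d]]
    by (auto simp: scalar_prod_def chain_matrix_def intro!: sum.cong)
  also have "\<dots> = (\<Sum>i\<in>{0..<2 * n}. ?K $$ (i, j) * (d $ (i mod n) * v $ i))"
    using v by (intro sum.cong) (auto simp: diag2_mult_vec)
  also have "\<dots> = row (g2_ctr n d v) 0 $ j"
  proof (cases "odd j")
    case True
    \<comment> \<open>column \<open>j\<close> of the output row holds \<open>c\<close> with subscript \<open>2k + 1 = 2n - j\<close>\<close>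
    define k where "k = (2 * n - 1 - j) div 2"
    have k: "k < n" "2 * (n - 1 - k) = j - 1"
      using True j unfolding k_def by (auto elim!: oddE)
    have "?K $$ (i, j) * (d $ (i mod n) * v $ i) = f_entry n d k (i mod n) * (v $ i)\<^sup>2"
      if "i < 2 * n" for i
    proof -
      have "i mod n < n" using that by (cases n) auto
      from coeff_cofactor_poly_even[OF this k(1), of d, unfolded k(2), symmetric] show ?thesis
        using that j True by (simp add: chain_matrix_def power2_eq_square)
    qed
    then show ?thesis using True j by (simp add: g2_ctr_def c_odd_sum[OF v] k_def)
  next
    case False
    then show ?thesis
      using v j by (simp add: sum_two_halves g2_ctr_def chain_matrix_def JJ_diag2_mult_vec mod_half)
  qed
  finally show "(transpose_mat ?K *\<^sub>v (diag2 n d *\<^sub>v v)) $ j = row (g2_ctr n d v) 0 $ j" .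
qed

lemma morphism_matrix_normal_form:
  assumes v: "v \<in> carrier_vec (2 * n)"
  shows "morphism_matrix (2 * n)
    (g1_ctr n d, unit_vec (2 * n) (2 * n - 1), row (g2_ctr n d v) 0)
    (JJ n * diag2 n d, v, diag2 n d *\<^sub>v v) (chain_matrix n d v)"
  using chain_matrix_equivariant[OF v] chain_matrix_last_col[OF v] chain_matrix_readout[OF v]
  by (simp add: morphism_matrix_def)

section \<open>Symplectic changes of coordinates\<close>

text \<open>
  Multiplying \<open>S\<^sup>T J S = J\<close> by \<open>J\<close> from the left and cancelling \<open>S\<close> gives \<open>J S\<^sup>T J = - S\<^sup>-\<^sup>1\<close>;
  one more factor \<open>J\<close> from the right removes the sign.
\<close>

lemma JJ_transpose_Sp:
  assumes S: "S \<in> Sp n"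
  shows "JJ n * transpose_mat S = minv S * JJ n"
proof -
  let ?N = "2 * n"
  have [simp]: "S \<in> carrier_mat ?N ?N" "transpose_mat S \<in> carrier_mat ?N ?N"
    "minv S \<in> carrier_mat ?N ?N"
    and sp: "transpose_mat S * JJ n * S = JJ n"
    using S minv_Sp(1)[OF S] by (auto simp: Sp_def)
  have [simp]: "A * B \<in> carrier_mat ?N ?N"
    if "A \<in> carrier_mat ?N ?N" "B \<in> carrier_mat ?N ?N" for A B :: "real mat"
    using that by (rule mult_carrier_mat)
  note assoc = assoc_mult_mat[of _ ?N ?N _ ?N _ ?N]
  have neg: "- 1\<^sub>m ?N * A = - A" "A * - 1\<^sub>m ?N = - A"
    if "A \<in> carrier_mat ?N ?N" for A :: "real mat"
    using that by simp_all
  have neg_mult: "B * - A = - (B * A)"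
    if "A \<in> carrier_mat ?N ?N" "B \<in> carrier_mat ?N ?N" for A B :: "real mat"
    using that by simp_all
  have "JJ n * transpose_mat S * JJ n = JJ n * transpose_mat S * JJ n * (S * minv S)"
    by (simp add: minv_Sp(3)[OF S] right_mult_one_mat[of _ ?N ?N])
  also have "\<dots> = JJ n * (transpose_mat S * JJ n * S) * minv S"
    by (simp add: assoc)
  also have "\<dots> = - minv S"
    by (simp add: sp JJ_square neg neg_mult)
  finally have "JJ n * transpose_mat S * JJ n * JJ n = - minv S * JJ n"
    by simp
  moreover have "JJ n * transpose_mat S * JJ n * JJ n = - (JJ n * transpose_mat S)"
    by (simp add: assoc JJ_square neg neg_mult right_mult_one_mat[of _ ?N ?N])
  moreover have "- minv S * JJ n = - (minv S * JJ n)"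
    using carrier_matD[OF JJ_carrier[of n]] carrier_matD[OF minv_Sp(1)[OF S]] by simp
  ultimately show ?thesis by (metis uminus_uminus_mat)
qed

text \<open>
  In the coordinates \<open>S z\<close> the port-Hamiltonian system with Hamiltonian \<open>S\<^sup>T D S\<close> becomes the one
  with Hamiltonian \<open>D\<close>, so every morphism into the latter lifts through \<open>S\<^sup>-\<^sup>1\<close>.
\<close>

lemma morphism_matrix_symplectic_change:
  assumes S: "S \<in> Sp n" and D: "D \<in> carrier_mat (2 * n) (2 * n)"
    and v: "v \<in> carrier_vec (2 * n)" and A: "A \<in> carrier_mat (2 * n) (2 * n)"
    and b: "b \<in> carrier_vec (2 * n)"
    and K: "morphism_matrix (2 * n) (A, b, c) (JJ n * D, v, D *\<^sub>v v) K"
  shows "morphism_matrix (2 * n) (A, b, c)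
    (JJ n * (transpose_mat S * D * S), minv S *\<^sub>v v,
      (transpose_mat S * D * S) *\<^sub>v (minv S *\<^sub>v v)) (minv S * K)"
proof -
  let ?N = "2 * n"
  have [simp]: "S \<in> carrier_mat ?N ?N" "transpose_mat S \<in> carrier_mat ?N ?N"
    "minv S \<in> carrier_mat ?N ?N" "K \<in> carrier_mat ?N ?N"
    using S K minv_Sp(1)[OF S] by (auto simp: Sp_def morphism_matrix_def)
  note [simp] = D v A b
  have KA: "K * A = JJ n * D * K" and Kb: "K *\<^sub>v b = v"
    and Kc: "transpose_mat K *\<^sub>v (D *\<^sub>v v) = c"
    using K by (auto simp: morphism_matrix_def)
  have [simp]: "P * R \<in> carrier_mat ?N ?N"
    if "P \<in> carrier_mat ?N ?N" "R \<in> carrier_mat ?N ?N" for P R :: "real mat"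
    using that by (rule mult_carrier_mat)
  have [simp]: "P *\<^sub>v z \<in> carrier_vec ?N"
    if "P \<in> carrier_mat ?N ?N" "z \<in> carrier_vec ?N" for P :: "real mat" and z
    using that by (rule mult_mat_vec_carrier)
  note assoc = assoc_mult_mat[of _ ?N ?N _ ?N _ ?N] and assoc_v = assoc_mult_mat_vec[of _ ?N ?N _ ?N]
  have "minv S * K * A = minv S * JJ n * D * K"
    by (simp add: assoc KA)
  also have "\<dots> = JJ n * transpose_mat S * D * (S * minv S) * K"
    by (simp add: JJ_transpose_Sp[OF S] minv_Sp(3)[OF S] right_mult_one_mat[of _ ?N ?N])
  also have "\<dots> = JJ n * (transpose_mat S * D * S) * (minv S * K)"
    by (simp add: assoc)
  finally have 1: "minv S * K * A = JJ n * (transpose_mat S * D * S) * (minv S * K)" .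
  have 2: "minv S * K *\<^sub>v b = minv S *\<^sub>v v"
    by (simp add: assoc_v Kb)
  have "(transpose_mat S * D * S) *\<^sub>v (minv S *\<^sub>v v) = transpose_mat S *\<^sub>v (D *\<^sub>v ((S * minv S) *\<^sub>v v))"
    by (simp add: assoc_v)
  also have "\<dots> = transpose_mat S *\<^sub>v (D *\<^sub>v v)"
    by (simp add: minv_Sp(3)[OF S])
  finally have QB: "(transpose_mat S * D * S) *\<^sub>v (minv S *\<^sub>v v) = transpose_mat S *\<^sub>v (D *\<^sub>v v)" .
  have "transpose_mat (minv S * K) * transpose_mat S = transpose_mat (S * minv S * K)"
    by (simp add: transpose_mult[of _ ?N ?N _ ?N] assoc)
  also have "\<dots> = transpose_mat K"
    by (simp add: minv_Sp(3)[OF S] left_mult_one_mat[of _ ?N ?N])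
  finally have "transpose_mat (minv S * K) *\<^sub>v (transpose_mat S *\<^sub>v (D *\<^sub>v v)) = c"
    using Kc by (subst assoc_v[symmetric]) simp_all
  then show ?thesis
    using 1 2 by (simp add: morphism_matrix_def QB)
qed

section \<open>Duality between input and output\<close>

text \<open>
  The sign is \<open>+ 1\<close> on odd indices, so that the last unit vector and the row
  \<open>[0, c\<^sub>2\<^sub>n\<^sub>-\<^sub>1, \<dots>, 0, c\<^sub>1]\<close> are both fixed.
\<close>

definition parity_mat :: "nat \<Rightarrow> real mat" where
  "parity_mat n = mat_diag (2 * n) (\<lambda>j. if odd j then 1 else - 1)"

lemma parity_mat_carrier [simp]: "parity_mat n \<in> carrier_mat (2 * n) (2 * n)"
  by (simp add: parity_mat_def)

lemma transpose_parity_mat: "transpose_mat (parity_mat n) = parity_mat n"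
  by (rule eq_matI) (auto simp: parity_mat_def mat_diag_def)

lemma parity_mat_mult_vec:
  assumes z: "z \<in> carrier_vec (2 * n)" and even: "\<And>j. j < 2 * n \<Longrightarrow> even j \<Longrightarrow> z $ j = 0"
  shows "parity_mat n *\<^sub>v z = z"
proof (rule eq_vecI)
  fix i assume "i < dim_vec z"
  then have i: "i < 2 * n" using z by auto
  have "(parity_mat n *\<^sub>v z) $ i =
      (\<Sum>j\<in>{0..<2 * n}. (if i = j then if odd j then 1 else - 1 else 0) * z $ j)"
    using z i by (simp add: parity_mat_def mat_diag_def scalar_prod_def)
  also have "\<dots> = (\<Sum>j\<in>{0..<2 * n}. if j = i then (if odd i then 1 else - 1) * z $ i else 0)"
    by (intro sum.cong) auto
  also have "\<dots> = z $ i"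
    using i even[OF i] by auto
  finally show "(parity_mat n *\<^sub>v z) $ i = z $ i" .
qed (use z in \<open>auto simp: parity_mat_def mat_diag_def\<close>)

text \<open>
  A nonzero entry of the companion matrix always joins indices of opposite parity: off the last
  row it lies on the superdiagonal, and in the last row, whose index \<open>2n - 1\<close> is odd, the
  coefficients \<open>a\<^sub>j\<close> with odd \<open>j\<close> vanish.
\<close>

lemma parity_mat_anticommute:
  "parity_mat n * transpose_mat (g1_ctr n d) = - (transpose_mat (g1_ctr n d) * parity_mat n)"
proof -
  have "transpose_mat (g1_ctr n d) \<in> carrier_mat (2 * n) (2 * n)"
    by simp
  then show ?thesis
    unfolding parity_mat_def
    by (subst mat_diag_mult_left, assumption, subst mat_diag_mult_right, assumption)
      (rule eq_matI, auto simp: g1_ctr_def a_coeff_odd)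
qed

text \<open>
  Transposition exchanges input and output vectors: \<open>K\<close> sends the last unit vector to \<open>B\<close>, hence
  \<open>K\<^sup>T Q\<close> pulls that unit vector back to the port-Hamiltonian readout \<open>Q B\<close>, and the readout
  identity of \<open>K\<close> says that \<open>K\<^sup>T Q\<close> sends \<open>B\<close> to the observable input vector. The only
  defect is the sign coming from \<open>J\<^sup>T = - J\<close>, which \<open>parity_mat\<close> corrects.
\<close>

lemma morphism_matrix_dual:
  assumes Q: "Q \<in> carrier_mat (2 * n) (2 * n)" "transpose_mat Q = Q"
    and B: "B \<in> carrier_vec (2 * n)" and n: "n \<ge> 1"
    and K: "morphism_matrix (2 * n)
      (g1_ctr n d, unit_vec (2 * n) (2 * n - 1), row (g2_ctr n d v) 0) (JJ n * Q, B, Q *\<^sub>v B) K"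
  shows "morphism_matrix (2 * n) (JJ n * Q, B, Q *\<^sub>v B)
    (transpose_mat (g1_ctr n d), row (g2_ctr n d v) 0, unit_vec (2 * n) (2 * n - 1))
    (parity_mat n * transpose_mat K * Q)"
proof -
  let ?N = "2 * n" and ?G = "g1_ctr n d" and ?E = "parity_mat n"
  have [simp]: "K \<in> carrier_mat ?N ?N"
    using K by (auto simp: morphism_matrix_def)
  note [simp] = Q B
  have KA: "K * ?G = JJ n * Q * K" and Kb: "K *\<^sub>v unit_vec ?N (?N - 1) = B"
    and Kc: "transpose_mat K *\<^sub>v (Q *\<^sub>v B) = row (g2_ctr n d v) 0"
    using K by (auto simp: morphism_matrix_def)
  have [simp]: "P * R \<in> carrier_mat ?N ?N"
    if "P \<in> carrier_mat ?N ?N" "R \<in> carrier_mat ?N ?N" for P R :: "real mat"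
    using that by (rule mult_carrier_mat)
  have [simp]: "P *\<^sub>v z \<in> carrier_vec ?N"
    if "P \<in> carrier_mat ?N ?N" "z \<in> carrier_vec ?N" for P :: "real mat" and z
    using that by (rule mult_mat_vec_carrier)
  have [simp]: "transpose_mat P \<in> carrier_mat ?N ?N" if "P \<in> carrier_mat ?N ?N" for P :: "real mat"
    using that by simp
  have neg: "P * (- R) = - (P * R)" "(- P) * R = - (P * R)"
    if "P \<in> carrier_mat ?N ?N" "R \<in> carrier_mat ?N ?N" for P R :: "real mat"
    using that by auto
  note assoc = assoc_mult_mat[of _ ?N ?N _ ?N _ ?N] and assoc_v = assoc_mult_mat_vec[of _ ?N ?N _ ?N]
    and tr = transpose_mult[of _ ?N ?N _ ?N]
  have "transpose_mat K * Q * JJ n = - transpose_mat (JJ n * Q * K)"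
    by (simp add: tr transpose_JJ assoc neg)
  also have "\<dots> = - (transpose_mat ?G * transpose_mat K)"
    by (simp flip: KA add: tr)
  finally have skew: "transpose_mat K * Q * JJ n = - (transpose_mat ?G * transpose_mat K)" .
  have "?E * transpose_mat K * Q * (JJ n * Q) = ?E * (transpose_mat K * Q * JJ n) * Q"
    by (simp add: assoc)
  also have "\<dots> = - (?E * transpose_mat ?G) * (transpose_mat K * Q)"
    unfolding skew by (simp add: assoc neg)
  also have "\<dots> = transpose_mat ?G * (?E * transpose_mat K * Q)"
    by (simp add: parity_mat_anticommute assoc)
  finally have 1: "?E * transpose_mat K * Q * (JJ n * Q) = transpose_mat ?G * (?E * transpose_mat K * Q)" .
  have "?E * transpose_mat K * Q *\<^sub>v B = ?E *\<^sub>v row (g2_ctr n d v) 0"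
    by (simp add: assoc_v Kc)
  also have "\<dots> = row (g2_ctr n d v) 0"
    by (rule parity_mat_mult_vec) (auto simp: g2_ctr_def)
  finally have 2: "?E * transpose_mat K * Q *\<^sub>v B = row (g2_ctr n d v) 0" .
  have "transpose_mat (?E * transpose_mat K * Q) *\<^sub>v unit_vec ?N (?N - 1) =
      Q *\<^sub>v (K *\<^sub>v (?E *\<^sub>v unit_vec ?N (?N - 1)))"
    by (simp add: tr transpose_parity_mat assoc_v)
  also have "?E *\<^sub>v unit_vec ?N (?N - 1) = unit_vec ?N (?N - 1)"
    using n by (intro parity_mat_mult_vec) auto
  finally have 3: "transpose_mat (?E * transpose_mat K * Q) *\<^sub>v unit_vec ?N (?N - 1) = Q *\<^sub>v B"
    unfolding Kb .
  show ?thesis using 1 2 3 by (simp add: morphism_matrix_def)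
qed

section \<open>The two parts\<close>

lemma phi_param_Theta_PH:
  assumes S: "S \<in> Sp n" and dv: "(d, v) \<in> Theta_CH n"
  shows "phi_param n S (d, v) \<in> Theta_PH n"
proof -
  let ?N = "2 * n" and ?Q = "transpose_mat S * diag2 n d * S"
  have Sc [simp]: "S \<in> carrier_mat ?N ?N" and Sinv [simp]: "minv S \<in> carrier_mat ?N ?N"
    using S minv_Sp(1)[OF S] by (auto simp: Sp_def)
  have v: "v \<in> carrier_vec ?N" and d: "\<forall>i<n. d $ i > 0"
    using dv by (auto simp: Theta_CH_def)
  have [simp]: "P * R \<in> carrier_mat ?N ?N"
    if "P \<in> carrier_mat ?N ?N" "R \<in> carrier_mat ?N ?N" for P R :: "real mat"
    using that by (rule mult_carrier_mat)
  have [simp]: "P *\<^sub>v z \<in> carrier_vec ?N"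
    if "P \<in> carrier_mat ?N ?N" "z \<in> carrier_vec ?N" for P :: "real mat" and z
    using that by (rule mult_mat_vec_carrier)
  have [simp]: "transpose_mat S \<in> carrier_mat ?N ?N" by simp
  note assoc = assoc_mult_mat[of _ ?N ?N _ ?N _ ?N] and assoc_v = assoc_mult_mat_vec[of _ ?N ?N _ ?N]
    and tr = transpose_mult[of _ ?N ?N _ ?N]
  have sym: "?Q = transpose_mat ?Q"
    by (simp add: tr transpose_diag2 assoc)
  \<comment> \<open>the quadratic form of \<open>S\<^sup>T \<Delta> S\<close> at \<open>z\<close> is that of \<open>\<Delta>\<close> at \<open>S z\<close>, and \<open>S\<close> is injective\<close>
  have pos: "z \<bullet> (?Q *\<^sub>v z) > 0" if z: "z \<in> carrier_vec ?N" and nz: "z \<noteq> 0\<^sub>v ?N" for z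
  proof -
    define y where "y = S *\<^sub>v z"
    have y: "y \<in> carrier_vec ?N" using z by (simp add: y_def)
    have "minv S *\<^sub>v y = z"
      using z by (simp add: y_def minv_Sp(2)[OF S] flip: assoc_v)
    moreover have "minv S *\<^sub>v 0\<^sub>v ?N = 0\<^sub>v ?N"
      using carrier_matD[OF Sinv] by (intro eq_vecI) auto
    ultimately have "y \<noteq> 0\<^sub>v ?N"
      using nz by auto
    then obtain i where i: "i < ?N" "y $ i \<noteq> 0"
      using y by (metis carrier_vecD eq_vecI index_zero_vec)
    have "z \<bullet> (?Q *\<^sub>v z) = z \<bullet> (transpose_mat S *\<^sub>v (diag2 n d *\<^sub>v y))"
      using z by (simp add: y_def assoc_v)
    also have "\<dots> = (diag2 n d *\<^sub>v y) \<bullet> y"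
      using z y transpose_vec_mult_scalar[OF Sc z, of "diag2 n d *\<^sub>v y"]
        comm_scalar_prod[of z ?N "transpose_mat S *\<^sub>v (diag2 n d *\<^sub>v y)"]
      by (simp add: y_def)
    also have "\<dots> = (\<Sum>j\<in>{0..<?N}. d $ (j mod n) * (y $ j)\<^sup>2)"
      using y by (auto simp: scalar_prod_def diag2_mult_vec power2_eq_square intro!: sum.cong)
    also have "\<dots> > 0"
    proof (rule sum_pos2[of _ i])
      have "d $ (j mod n) > 0" if "j < ?N" for j
        using that d by (cases n) auto
      then show "d $ (i mod n) * (y $ i)\<^sup>2 > 0"
        "\<And>j. j \<in> {0..<?N} \<Longrightarrow> 0 \<le> d $ (j mod n) * (y $ j)\<^sup>2"
        using i by (auto simp: less_imp_le)
    qed (use i in auto)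
    finally show ?thesis .
  qed
  show ?thesis
    using v sym pos by (simp add: phi_param_def Theta_PH_def pos_def_mat_def)
qed

lemma morphism_matrix_CH_PH:
  assumes S: "S \<in> Sp n" and v: "v \<in> carrier_vec (2 * n)"
  shows "morphism_matrix (2 * n)
    (g1_ctr n d, unit_vec (2 * n) (2 * n - 1), row (g2_ctr n d v) 0)
    (JJ n * (transpose_mat S * diag2 n d * S), minv S *\<^sub>v v,
      (transpose_mat S * diag2 n d * S) *\<^sub>v (minv S *\<^sub>v v))
    (minv S * chain_matrix n d v)"
  using S v by (intro morphism_matrix_symplectic_change morphism_matrix_normal_form) auto

theorem theorem2:
  fixes n :: nat
  assumes "n \<ge> 1"
  shows
    "(\<forall>S\<in>Sp n.
        phi_param n S \<in> Theta_CH n \<rightarrow> Theta_PH n \<and>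
        phi n S \<in> Theta_CH n \<rightarrow> PH n \<and>
        (\<forall>(d, v)\<in>Theta_CH n.
           \<exists>f. linear_system_morphism (2 * n) (2 * n) (theta_CH n d v) (phi n S (d, v)) f)) \<and>
     (\<forall>Q B S d. (Q, B) \<in> Theta_PH n \<longrightarrow> williamson_decomposition n Q S d \<longrightarrow>
        (d, S *\<^sub>v B) \<in> Theta_OH n \<and> theta_OH n d (S *\<^sub>v B) \<in> OH n \<and>
        (\<exists>f. linear_system_morphism (2 * n) (2 * n) (theta_PH n Q B) (theta_OH n d (S *\<^sub>v B)) f))"
proof (intro conjI ballI allI impI)
  fix S assume S: "S \<in> Sp n"
  show param: "phi_param n S \<in> Theta_CH n \<rightarrow> Theta_PH n"
    using phi_param_Theta_PH[OF S] by auto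
  then show "phi n S \<in> Theta_CH n \<rightarrow> PH n"
    by (auto simp: phi_def PH_def Pi_iff split: prod.splits) metis
  fix p assume p: "p \<in> Theta_CH n"
  obtain d v where dv: "p = (d, v)" by (cases p)
  define Q where "Q = transpose_mat S * diag2 n d * S"
  have QB: "(Q, minv S *\<^sub>v v) \<in> Theta_PH n"
    using phi_param_Theta_PH[OF S p[unfolded dv]] by (simp add: phi_param_def Q_def)
  have "represents (2 * n) (phi n S (d, v)) (JJ n * Q) (minv S *\<^sub>v v) (Q *\<^sub>v (minv S *\<^sub>v v))"
    using represents_theta_PH[of Q n] QB by (simp add: phi_def phi_param_def Theta_PH_def Q_def)
  then have "linear_system_morphism (2 * n) (2 * n) (theta_CH n d v) (phi n S (d, v))
      (\<lambda>z. (minv S * chain_matrix n d v) *\<^sub>v z)"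
    using morphism_matrix_CH_PH[OF S, of v d] p dv unfolding Q_def Theta_CH_def
    by (intro linear_system_morphism_of_matrix[OF represents_theta_CH]) auto
  then show "case p of (d, v) \<Rightarrow>
      \<exists>f. linear_system_morphism (2 * n) (2 * n) (theta_CH n d v) (phi n S (d, v)) f"
    using dv by auto
next
  fix Q B S d
  assume QB: "(Q, B) \<in> Theta_PH n" and W: "williamson_decomposition n Q S d"
  have S: "S \<in> Sp n" and Q_eq: "Q = transpose_mat S * diag2 n d * S"
    using W by (auto simp: williamson_decomposition_def)
  have Sc: "S \<in> carrier_mat (2 * n) (2 * n)"
    using S by (simp add: Sp_def)
  have Q: "Q \<in> carrier_mat (2 * n) (2 * n)" "transpose_mat Q = Q"
    and B: "B \<in> carrier_vec (2 * n)"
    using QB by (auto simp: Theta_PH_def)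
  have v: "S *\<^sub>v B \<in> carrier_vec (2 * n)"
    using Sc B by (rule mult_mat_vec_carrier)
  show dv: "(d, S *\<^sub>v B) \<in> Theta_OH n"
    using W v by (simp add: Theta_OH_def Theta_CH_def williamson_decomposition_def)
  then show "theta_OH n d (S *\<^sub>v B) \<in> OH n"
    by (auto simp: OH_def)
  have "minv S *\<^sub>v (S *\<^sub>v B) = (minv S * S) *\<^sub>v B"
    by (rule assoc_mult_mat_vec[OF minv_Sp(1)[OF S] Sc B, symmetric])
  then have inv: "minv S *\<^sub>v (S *\<^sub>v B) = B"
    using B by (simp add: minv_Sp(2)[OF S])
  \<comment> \<open>\<open>(Q, B)\<close> is the image under \<open>phi_param n S\<close> of \<open>(d, S *\<^sub>v B)\<close>, so part (i) can be dualized\<close>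
  show "\<exists>f. linear_system_morphism (2 * n) (2 * n) (theta_PH n Q B) (theta_OH n d (S *\<^sub>v B)) f"
    using morphism_matrix_dual[OF Q B assms
        morphism_matrix_CH_PH[OF S v, of d, folded Q_eq, unfolded inv]]
    by (blast intro: linear_system_morphism_of_matrix represents_theta_PH[OF Q B] represents_theta_OH)
qed

end
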